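(* Let $x^*\in\mathcal{X}$ be an optimal solution of the distributionally robust problem $$\inf_{x\in\mathcal{X}}\ \sup_{\mathbb{P}\in\mathcal{P}}\ \mathbb{E}_{s\sim\mathbb{P}}[f(x,s)] ,\qquad\text{(DRO)}$$ where $f$ satisfies the monotonicity and positive homogeneity assumptions stated in the context. Let $\{\mathcal{S}_1,\dots,\mathcal{S}_K\}$ be a partition of $\mathcal{S}$ with representative scenarios $\tilde{\mathcal{S}}=\{\tilde s_1,\dots,\tilde s_K\}$, where every $s\in\mathcal{S}$ and every $\tilde s\in\tilde{\mathcal{S}}$ is strictly positive in every component. Let $\alpha,\beta>0$ be such that for every $j=1,\dots,K$ and every $s\in\mathcal{S}_j$ one has, componentwise, $s\le\alpha\tilde s_j$ and $\tilde s_j\le\beta s$. Then every optimal solution $\tilde x\in\mathcal{X}$ of the reduced problem $$\inf_{x\in\mathcal{X}}\ \sup_{\tilde p\in\tilde{\mathcal{P}}}\ \sum_{j=1}^K f(x,\tilde s_j)\,\tilde p_j \qquad\text{(DROred)}$$ is an $\alpha\beta$-approximation of (DRO), i.e. $$\sup_{\mathbb{P}\in\mathcal{P}}\mathbb{E}_{s\sim\mathbb{P}}[f(\tilde x,s)]\ \le\ \alpha\beta\ \sup_{\mathbb{P}\in\mathcal{P}}\mathbb{E}_{s\sim\mathbb{P}}[f(x^*,s)].$$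
   Context: $\mathcal{X}\subseteq\mathbb{R}^n$ is the feasible set (arbitrary, possibly with discrete variables), $\mathcal{S}\subseteq\mathbb{R}^m$ is the scenario set (discrete or continuous, Borel), and the ambiguity set $\mathcal{P}$ is an arbitrary nonempty set of Borel probability measures on $\mathcal{S}$; $\mathbb{E}_{s\sim\mathbb{P}}[f(x,s)]=\int_{\mathcal{S}}f(x,s)\,\mathbb{P}(\mathrm{d}s)$. All inequalities between vectors are componentwise. Assumptions on the objective $f:\mathbb{R}^n\times\mathbb{R}^m\to\mathbb{R}$: (i) Monotonicity: for every fixed $x\in\mathcal{X}$ and all $s,\tilde s\in\mathbb{R}^m$, $s\le\tilde s$ implies $f(x,s)\le f(x,\tilde s)$. (ii) Positive homogeneity: for all $x\in\mathcal{X}$, $s\in\mathbb{R}^m$ and $\alpha>0$, $f(x,\alpha s)\le\alpha f(x,s)$. A partition means $\mathcal{S}=\bigcup_{j=1}^K\mathcal{S}_j$ with the (Borel) sets $\mathcal{S}_j$ pairwise disjoint. The scenario $\tilde s_j\in\mathbb{R}^m$ represents $\mathcal{S}_j$ (it need not belong to $\mathcal{S}_j$). The reduced ambiguity set is $$\tilde{\mathcal{P}}=\Big\{\tilde p\in[0,1]^K:\ \tilde p_j=\int_{\mathcal{S}_j}\mathbb{P}(\mathrm{d}s)\ \ (j=1,\dots,K),\ \mathbb{P}\in\mathcal{P}\Big\}.$$ *)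

theory Defs
  imports "HOL-Probability.Probability"
begin

text \<open>
  Vectors are of type \<^typ>\<open>real ^ 'd\<close>, on which \<open>\<le>\<close> is the componentwise order (but \<open><\<close> is not
  the componentwise strict order, hence \<open>pos_vec\<close>). The cells of the partition are indexed by
  a finite type \<open>'k\<close> with \<open>K = CARD('k)\<close>.
\<close>

definition pos_vec :: "real ^ 'd \<Rightarrow> bool" where
  "pos_vec s \<longleftrightarrow> (\<forall>i. 0 < s $ i)"

definition borel_prob_measures :: "(real ^ 'd) set \<Rightarrow> (real ^ 'd) measure set" where
  "borel_prob_measures S = {P. prob_space P \<and> sets P = sets (restrict_space borel S)}"

definition monotone_objective ::
    "(real ^ 'n) set \<Rightarrow> (real ^ 'n \<Rightarrow> real ^ 'm \<Rightarrow> real) \<Rightarrow> bool" where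
  "monotone_objective X f \<longleftrightarrow> (\<forall>x\<in>X. \<forall>s t. s \<le> t \<longrightarrow> f x s \<le> f x t)"

definition pos_homogeneous_objective ::
    "(real ^ 'n) set \<Rightarrow> (real ^ 'n \<Rightarrow> real ^ 'm \<Rightarrow> real) \<Rightarrow> bool" where
  "pos_homogeneous_objective X f \<longleftrightarrow>
     (\<forall>x\<in>X. \<forall>s. \<forall>a>0. f x (a *\<^sub>R s) \<le> a * f x s)"

definition scenario_partition :: "(real ^ 'm) set \<Rightarrow> ('k::finite \<Rightarrow> (real ^ 'm) set) \<Rightarrow> bool" where
  "scenario_partition S C \<longleftrightarrow>
     (\<forall>j. C j \<in> sets borel) \<and> disjoint_family C \<and> S = (\<Union>j. C j)"

text \<open>
  The suprema are taken in \<^typ>\<open>ereal\<close>, so that they need not be assumed finite. The Bochner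
  integral, which returns 0 on non-integrable functions, is harmless here: an objective that is
  monotone and positively homogeneous in the scenario is nonnegative and continuous on the
  open positive orthant, and on a scenario set with \<open>s \<le> \<alpha> *\<^sub>R r j\<close> on each of the finitely many
  cells it is also bounded, hence integrable for every probability measure on that set.
\<close>

definition dro_value ::
    "(real ^ 'n \<Rightarrow> real ^ 'm \<Rightarrow> real) \<Rightarrow> (real ^ 'm) measure set \<Rightarrow> real ^ 'n \<Rightarrow> ereal" where
  "dro_value f \<P> x = (SUP P\<in>\<P>. ereal (\<integral>s. f x s \<partial>P))"

definition reduced_ambiguity ::
    "(real ^ 'm) measure set \<Rightarrow> ('k::finite \<Rightarrow> (real ^ 'm) set) \<Rightarrow> (real ^ 'k) set" where
  "reduced_ambiguity \<P> C =
     {p. (\<forall>j. p $ j \<in> {0..1}) \<and> (\<exists>P\<in>\<P>. \<forall>j. p $ j = measure P (C j))}"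

definition reduced_dro_value ::
    "(real ^ 'n \<Rightarrow> real ^ 'm \<Rightarrow> real) \<Rightarrow> ('k::finite \<Rightarrow> real ^ 'm) \<Rightarrow> (real ^ 'k) set
       \<Rightarrow> real ^ 'n \<Rightarrow> ereal" where
  "reduced_dro_value f r Q x = (SUP p\<in>Q. ereal (\<Sum>j\<in>UNIV. f x (r j) * p $ j))"

end

theory Submission
  imports Defs
begin

text \<open>
  Fix a feasible \<open>x\<close> and let \<open>h = f x\<close>. Monotonicity and \<open>h (a s) \<le> a h s\<close> turn the two bounds on a
  cell into \<open>h s \<le> \<alpha> h (r j)\<close> and \<open>h (r j) \<le> \<beta> h s\<close> for \<open>s \<in> C j\<close>. Thus the objective and the step
  function with value \<open>f x (r j)\<close> on \<open>C j\<close> dominate each other up to the factors \<open>\<alpha>\<close> and \<open>\<beta>\<close>. The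
  expectation of the step function under \<open>P\<close> is the reduced objective at the vector of cell
  probabilities, so taking suprema bounds the full and the reduced worst-case values by each other,
  for every feasible \<open>x\<close>
  (\<open>dro_value_le_reduced\<close>, \<open>reduced_le_dro_value\<close>). Optimality of \<open>x_red\<close> then links the two chains:
  full value at \<open>x_red\<close> \<open>\<le> \<alpha> \<cdot>\<close> reduced value at \<open>x_red\<close> \<open>\<le> \<alpha> \<cdot>\<close> reduced value at \<open>x_opt\<close>
  \<open>\<le> \<alpha>\<beta> \<cdot>\<close> full value at \<open>x_opt\<close>.

  The comparison of expectations requires \<open>h\<close> to be integrable. Applying homogeneity again with
  \<open>1 / a\<close> gives \<open>h (a s) = a h s\<close>, so \<open>h\<close> vanishes at the origin and is nonnegative on the positive
  orthant. Near a positive point \<open>c\<close>, monotonicity squeezes \<open>h\<close> between \<open>(1 - t) h c\<close> and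
  \<open>(1 + t) h c\<close>, so \<open>h\<close> is continuous on that orthant, hence Borel on \<open>S\<close>; there it is bounded by
  \<open>\<alpha>\<close> times the step function.
\<close>

section \<open>Monotone positively homogeneous functions on the positive orthant\<close>

lemma pos_homogeneous_eq:
  fixes h :: "'a::real_vector \<Rightarrow> real"
  assumes hom: "\<And>a s. a > 0 \<Longrightarrow> h (a *\<^sub>R s) \<le> a * h s" and "a > 0"
  shows "h (a *\<^sub>R s) = a * h s"
proof (rule antisym)
  have "h ((1 / a) *\<^sub>R (a *\<^sub>R s)) \<le> (1 / a) * h (a *\<^sub>R s)"
    using \<open>a > 0\<close> by (intro hom) simp
  then show "a * h s \<le> h (a *\<^sub>R s)"
    using \<open>a > 0\<close> by (simp add: field_simps)
qed (use assms in blast)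

text \<open>Homogeneity forces \<open>h 0 = 2 * h 0\<close>, so \<open>h\<close> vanishes at the origin, which lies below \<open>s\<close>.\<close>

lemma mono_pos_homogeneous_nonneg:
  fixes h :: "real ^ 'd \<Rightarrow> real"
  assumes "mono h" and hom: "\<And>a s. a > 0 \<Longrightarrow> h (a *\<^sub>R s) \<le> a * h s" and "0 \<le> s"
  shows "0 \<le> h s"
proof -
  have "h (2 *\<^sub>R 0) = 2 * h 0"
    by (rule pos_homogeneous_eq[of h]) (use hom in auto)
  then have "h 0 = 0" by simp
  then show ?thesis using monoD[OF \<open>mono h\<close> \<open>0 \<le> s\<close>] by simp
qed

text \<open>
  A positive point \<open>c\<close> is interior to the order interval from \<open>(1 - t) c\<close> to \<open>(1 + t) c\<close>, on which
  \<open>h\<close> varies by at most \<open>t * h c\<close> around \<open>h c\<close>.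
\<close>

lemma mono_pos_homogeneous_isCont:
  fixes h :: "real ^ 'd \<Rightarrow> real"
  assumes "mono h" and hom: "\<And>a s. a > 0 \<Longrightarrow> h (a *\<^sub>R s) \<le> a * h s" and "pos_vec c"
  shows "isCont h c"
  unfolding isCont_def
proof (rule tendstoI)
  fix e :: real assume "e > 0"
  have "0 \<le> c" using \<open>pos_vec c\<close> by (simp add: pos_vec_def less_eq_vec_def less_imp_le)
  with assms(1) hom have "0 \<le> h c" by (rule mono_pos_homogeneous_nonneg)
  \<comment> \<open>The denominator makes \<open>t * h c < e\<close> also when \<open>h c = 0\<close>; \<open>t < 1\<close> keeps \<open>1 - t\<close> positive.\<close>
  define t where "t = min (1 / 2) (e / (h c + 1))"
  have t: "0 < t" "t < 1" using \<open>e > 0\<close> \<open>0 \<le> h c\<close> by (auto simp: t_def)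
  have "t \<le> e / (h c + 1)" by (simp add: t_def)
  then have "t * (h c + 1) \<le> e" using \<open>0 \<le> h c\<close> by (simp add: pos_le_divide_eq)
  then have "t * h c < e" using t by (simp add: algebra_simps)
  have near: "eventually (\<lambda>s. \<forall>i. (1 - t) * c $ i < s $ i \<and> s $ i < (1 + t) * c $ i) (at c)"
  proof (intro eventually_all_finite eventually_conj)
    fix i
    have lim: "((\<lambda>s. s $ i) \<longlongrightarrow> c $ i) (at c)" by (intro tendsto_intros)
    have "0 < c $ i" using \<open>pos_vec c\<close> by (simp add: pos_vec_def)
    then have "(1 - t) * c $ i < c $ i" "c $ i < (1 + t) * c $ i"
      using t by (simp_all add: algebra_simps)
    then show "eventually (\<lambda>s. (1 - t) * c $ i < s $ i) (at c)"
      and "eventually (\<lambda>s. s $ i < (1 + t) * c $ i) (at c)"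
      using order_tendstoD[OF lim] by auto
  qed
  show "eventually (\<lambda>s. dist (h s) (h c) < e) (at c)"
    using near
  proof eventually_elim
    case (elim s)
    then have le: "(1 - t) *\<^sub>R c \<le> s" "s \<le> (1 + t) *\<^sub>R c"
      by (simp_all add: less_eq_vec_def less_imp_le)
    have "h ((1 - t) *\<^sub>R c) = (1 - t) * h c" "h ((1 + t) *\<^sub>R c) = (1 + t) * h c"
      using t by (auto intro!: pos_homogeneous_eq hom)
    then have "(1 - t) * h c \<le> h s" "h s \<le> (1 + t) * h c"
      using monoD[OF \<open>mono h\<close> le(1)] monoD[OF \<open>mono h\<close> le(2)] by simp_all
    then have "\<bar>h s - h c\<bar> \<le> t * h c" by (auto simp: abs_le_iff algebra_simps)
    then show ?case using \<open>t * h c < e\<close> by (simp add: dist_real_def)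
  qed
qed

section \<open>Expectations against a partition\<close>

lemma borel_prob_measuresD:
  assumes "P \<in> borel_prob_measures S"
  shows "prob_space P" and "sets P = sets (restrict_space borel S)" and "space P = S"
  using assms sets_eq_imp_space_eq[of P "restrict_space borel S"]
  by (auto simp: borel_prob_measures_def space_restrict_space)

lemma scenario_partition_sets:
  assumes "scenario_partition S C" and "P \<in> borel_prob_measures S"
  shows "C j \<in> sets P"
proof -
  have "C j \<in> sets borel" "C j = S \<inter> C j"
    using assms(1) by (auto simp: scenario_partition_def)
  then show ?thesis
    unfolding borel_prob_measuresD(2)[OF assms(2)] sets_restrict_space by blast
qed

lemma step_function_eq:
  fixes C :: "'k::finite \<Rightarrow> (real ^ 'm) set" and v :: "'k \<Rightarrow> real"
  assumes "scenario_partition S C" and "s \<in> C j"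
  shows "(\<Sum>i\<in>UNIV. v i * indicator (C i) s) = v j"
proof -
  have "s \<notin> C i" if "i \<noteq> j" for i
    using assms that by (auto simp: scenario_partition_def disjoint_family_on_def)
  then have "(\<Sum>i\<in>UNIV. v i * indicator (C i) s) = (\<Sum>i\<in>UNIV. if i = j then v j else 0)"
    using assms(2) by (intro sum.cong) (auto simp: indicator_def)
  then show ?thesis by simp
qed

lemma has_integral_step_function:
  fixes C :: "'k::finite \<Rightarrow> (real ^ 'm) set" and v :: "'k \<Rightarrow> real"
  assumes "scenario_partition S C" and P: "P \<in> borel_prob_measures S"
  shows "has_bochner_integral P (\<lambda>s. \<Sum>j\<in>UNIV. v j * indicator (C j) s)
    (\<Sum>j\<in>UNIV. v j * measure P (C j))"
proof (intro has_bochner_integral_sum has_bochner_integral_mult_right)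
  interpret prob_space P by (rule borel_prob_measuresD(1)[OF P])
  show "has_bochner_integral P (indicator (C j)) (measure P (C j))" for j
    using scenario_partition_sets[OF assms]
    by (intro has_bochner_integral_real_indicator) (simp_all add: emeasure_eq_measure)
qed

text \<open>
  Both comparisons are the pointwise estimates \<open>h s \<le> \<alpha> g s\<close> and \<open>g s \<le> \<beta> h s\<close> integrated, where
  \<open>g\<close> is the step function with value \<open>h (r j)\<close> on \<open>C j\<close>.
\<close>

lemma expectation_cell_sandwich:
  fixes h :: "real ^ 'm \<Rightarrow> real" and C :: "'k::finite \<Rightarrow> (real ^ 'm) set"
  assumes mono: "mono h" and hom: "\<And>a s. a > 0 \<Longrightarrow> h (a *\<^sub>R s) \<le> a * h s"
    and part: "scenario_partition S C" and P: "P \<in> borel_prob_measures S"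
    and pos: "\<And>s. s \<in> S \<Longrightarrow> pos_vec s"
    and "\<alpha> > 0" and "\<beta> > 0"
    and upper: "\<And>j s. s \<in> C j \<Longrightarrow> s \<le> \<alpha> *\<^sub>R r j"
    and lower: "\<And>j s. s \<in> C j \<Longrightarrow> r j \<le> \<beta> *\<^sub>R s"
  shows "(\<integral>s. h s \<partial>P) \<le> \<alpha> * (\<Sum>j\<in>UNIV. h (r j) * measure P (C j))"
    and "(\<Sum>j\<in>UNIV. h (r j) * measure P (C j)) \<le> \<beta> * (\<integral>s. h s \<partial>P)"
proof -
  note space = borel_prob_measuresD(3)[OF P]
  define g where "g = (\<lambda>s. \<Sum>j\<in>UNIV. h (r j) * indicator (C j) s)"
  have bounds: "0 \<le> h s \<and> h s \<le> \<alpha> * g s \<and> g s \<le> \<beta> * h s" if "s \<in> S" for s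
  proof -
    obtain j where j: "s \<in> C j" using part \<open>s \<in> S\<close> by (auto simp: scenario_partition_def)
    have g: "g s = h (r j)" unfolding g_def by (rule step_function_eq[OF part j])
    have "0 \<le> s" using pos[OF that] by (simp add: pos_vec_def less_eq_vec_def less_imp_le)
    with mono hom have "0 \<le> h s" by (rule mono_pos_homogeneous_nonneg)
    moreover have "h s \<le> \<alpha> * h (r j)"
      using monoD[OF mono upper[OF j]] hom[OF \<open>\<alpha> > 0\<close>] by (rule order_trans)
    moreover have "h (r j) \<le> \<beta> * h s"
      using monoD[OF mono lower[OF j]] hom[OF \<open>\<beta> > 0\<close>] by (rule order_trans)
    ultimately show ?thesis using g by simp
  qed
  have "has_bochner_integral P g (\<Sum>j\<in>UNIV. h (r j) * measure P (C j))"
    unfolding g_def by (rule has_integral_step_function[OF part P])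
  then have g_int: "integrable P g" and g_eq: "(\<integral>s. g s \<partial>P) = (\<Sum>j\<in>UNIV. h (r j) * measure P (C j))"
    by (simp_all add: has_bochner_integral_iff)
  have "continuous_on S h"
    using mono_pos_homogeneous_isCont[OF mono hom pos] by (simp add: continuous_at_imp_continuous_on)
  then have "h \<in> borel_measurable (restrict_space borel S)"
    by (rule borel_measurable_continuous_on_restrict)
  then have meas: "h \<in> borel_measurable P"
    using measurable_cong_sets[OF borel_prob_measuresD(2)[OF P] refl] by blast
  have h_int: "integrable P h"
    by (rule Bochner_Integration.integrable_bound[OF integrable_mult_right[OF g_int, of \<alpha>] meas])
      (use bounds space in \<open>fastforce intro!: AE_I2\<close>)
  have "(\<integral>s. h s \<partial>P) \<le> (\<integral>s. \<alpha> * g s \<partial>P)"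
    using bounds space by (intro integral_mono h_int integrable_mult_right g_int) auto
  then show "(\<integral>s. h s \<partial>P) \<le> \<alpha> * (\<Sum>j\<in>UNIV. h (r j) * measure P (C j))"
    by (simp add: g_eq)
  have "(\<integral>s. g s \<partial>P) \<le> (\<integral>s. \<beta> * h s \<partial>P)"
    using bounds space by (intro integral_mono h_int integrable_mult_right g_int) auto
  then show "(\<Sum>j\<in>UNIV. h (r j) * measure P (C j)) \<le> \<beta> * (\<integral>s. h s \<partial>P)"
    by (simp add: g_eq)
qed

section \<open>Worst-case values\<close>

lemma cell_probabilities_in_reduced_ambiguity:
  assumes "P \<in> \<P>" and "prob_space P"
  shows "(\<chi> j. measure P (C j)) \<in> reduced_ambiguity \<P> C"
  using assms by (auto simp: reduced_ambiguity_def prob_space.prob_le_1)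

lemma dro_value_le_reduced:
  assumes prob: "\<And>P. P \<in> \<P> \<Longrightarrow> prob_space P" and "0 \<le> a"
    and le: "\<And>P. P \<in> \<P> \<Longrightarrow> (\<integral>s. f x s \<partial>P) \<le> a * (\<Sum>j\<in>UNIV. f x (r j) * measure P (C j))"
  shows "dro_value f \<P> x \<le> ereal a * reduced_dro_value f r (reduced_ambiguity \<P> C) x"
  unfolding dro_value_def
proof (rule SUP_least)
  fix P assume P: "P \<in> \<P>"
  have "ereal (\<Sum>j\<in>UNIV. f x (r j) * (\<chi> j. measure P (C j)) $ j)
      \<le> reduced_dro_value f r (reduced_ambiguity \<P> C) x"
    unfolding reduced_dro_value_def
    by (rule SUP_upper) (rule cell_probabilities_in_reduced_ambiguity[OF P prob[OF P]])
  then have "ereal a * ereal (\<Sum>j\<in>UNIV. f x (r j) * measure P (C j))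
      \<le> ereal a * reduced_dro_value f r (reduced_ambiguity \<P> C) x"
    using \<open>0 \<le> a\<close> by (intro ereal_mult_left_mono) simp_all
  moreover have "ereal (\<integral>s. f x s \<partial>P) \<le> ereal a * ereal (\<Sum>j\<in>UNIV. f x (r j) * measure P (C j))"
    using le[OF P] by simp
  ultimately show "ereal (\<integral>s. f x s \<partial>P) \<le> ereal a * reduced_dro_value f r (reduced_ambiguity \<P> C) x"
    by (rule order_trans[rotated])
qed

lemma reduced_le_dro_value:
  assumes "0 \<le> b"
    and le: "\<And>P. P \<in> \<P> \<Longrightarrow> (\<Sum>j\<in>UNIV. f x (r j) * measure P (C j)) \<le> b * (\<integral>s. f x s \<partial>P)"
  shows "reduced_dro_value f r (reduced_ambiguity \<P> C) x \<le> ereal b * dro_value f \<P> x"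
  unfolding reduced_dro_value_def
proof (rule SUP_least)
  fix p assume "p \<in> reduced_ambiguity \<P> C"
  then obtain P where P: "P \<in> \<P>" and p: "\<And>j. p $ j = measure P (C j)"
    by (auto simp: reduced_ambiguity_def)
  have "ereal (\<Sum>j\<in>UNIV. f x (r j) * p $ j) \<le> ereal b * ereal (\<integral>s. f x s \<partial>P)"
    using le[OF P] by (simp add: p)
  also have "\<dots> \<le> ereal b * dro_value f \<P> x"
    unfolding dro_value_def using \<open>0 \<le> b\<close> P by (intro ereal_mult_left_mono SUP_upper) simp_all
  finally show "ereal (\<Sum>j\<in>UNIV. f x (r j) * p $ j) \<le> ereal b * dro_value f \<P> x" .
qed

theorem theorem2p4:
  fixes X :: "(real ^ 'n) set"
    and S :: "(real ^ 'm) set"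
    and \<P> :: "(real ^ 'm) measure set"
    and f :: "real ^ 'n \<Rightarrow> real ^ 'm \<Rightarrow> real"
    and C :: "'k::finite \<Rightarrow> (real ^ 'm) set"
    and r :: "'k \<Rightarrow> real ^ 'm"
    and \<alpha> \<beta> :: real
    and x_opt x_red :: "real ^ 'n"
  assumes "S \<in> sets borel"
    and "\<P> \<noteq> {}"
    and "\<P> \<subseteq> borel_prob_measures S"
    and "monotone_objective X f"
    and "pos_homogeneous_objective X f"
    and "scenario_partition S C"
    and "\<And>s. s \<in> S \<Longrightarrow> pos_vec s"
    and "\<And>j. pos_vec (r j)"
    and "\<alpha> > 0" and "\<beta> > 0"
    and "\<And>j s. s \<in> C j \<Longrightarrow> s \<le> \<alpha> *\<^sub>R r j"
    and "\<And>j s. s \<in> C j \<Longrightarrow> r j \<le> \<beta> *\<^sub>R s"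
    and "is_arg_min (dro_value f \<P>) (\<lambda>x. x \<in> X) x_opt"
    and "is_arg_min (reduced_dro_value f r (reduced_ambiguity \<P> C)) (\<lambda>x. x \<in> X) x_red"
  shows "dro_value f \<P> x_red \<le> ereal (\<alpha> * \<beta>) * dro_value f \<P> x_opt"
proof -
  let ?red = "reduced_dro_value f r (reduced_ambiguity \<P> C)"
  have X: "x_opt \<in> X" "x_red \<in> X"
    using assms(13,14) by (auto simp: is_arg_min_def)
  have prob: "prob_space P" if "P \<in> \<P>" for P
    using that assms(3) borel_prob_measuresD(1) by blast
  have mono: "mono (f x)" if "x \<in> X" for x
    using that assms(4) by (auto simp: monotone_objective_def intro!: monoI)
  have hom: "f x (a *\<^sub>R s) \<le> a * f x s" if "x \<in> X" "a > 0" for x a s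
    using that assms(5) by (auto simp: pos_homogeneous_objective_def)
  note sandwich = expectation_cell_sandwich[OF mono hom assms(6) subsetD[OF assms(3)]
      assms(7) assms(9) assms(10) assms(11) assms(12)]
  have "dro_value f \<P> x_red \<le> ereal \<alpha> * ?red x_red"
    using sandwich(1)[OF X(2) X(2)] assms(9) by (intro dro_value_le_reduced prob) auto
  also have "\<dots> \<le> ereal \<alpha> * ?red x_opt"
    using assms(9,14) X(1) by (intro ereal_mult_left_mono) (auto simp: is_arg_min_def not_less)
  also have "\<dots> \<le> ereal \<alpha> * (ereal \<beta> * dro_value f \<P> x_opt)"
    using sandwich(2)[OF X(1) X(1)] assms(9,10)
    by (intro ereal_mult_left_mono reduced_le_dro_value) auto
  finally show ?thesis by (simp add: mult.assoc flip: times_ereal.simps(1))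
qed

end
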